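(* Let $(X,p)$ be a TVS-cone metric space over a cone $P$ in a real Hausdorff locally convex topological vector space $E$. Then $(X,\tau_p)$ is a paracompact topological space, and hence a $T_4$ space.
   Context: $E$ is a real Hausdorff locally convex topological vector space. A cone is a non-empty subset $P\subset E$ with $P+P\subset P$, $\lambda P\subset P$ for all $\lambda\ge 0$, and $P\cap(-P)=\{0\}$; $P$ is always assumed closed with nonempty interior $\operatorname{int}P$. Write $x\le y$ iff $y-x\in P$, and $x\ll y$ iff $y-x\in\operatorname{int}P$. A TVS-cone metric space (TVS-CMS) $(X,p)$ is a non-empty set $X$ with a map $p:X\times X\to E$ such that for all $x,y,z\in X$: $0\le p(x,y)$; $p(x,y)=0$ iff $x=y$; $p(x,y)=p(y,x)$; $p(x,y)\le p(x,z)+p(z,y)$. For $x\in X$ and $c\gg 0$ put $B(x,c)=\{y\in X: p(x,y)\ll c\}$; the topology of $(X,p)$ is $\tau_p=\{U\subseteq X: \forall x\in U\ \exists c\gg 0 \text{ with } B(x,c)\subseteq U\}\cup\{\emptyset\}$. *)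

theory Defs
  imports "HOL-Analysis.Analysis"
begin

text \<open>A class assumption cannot mention \<^const>\<open>convex\<close>, which is defined outside the class
  \<^class>\<open>real_vector\<close>, so its definition is written out.\<close>

class hausdorff_lctvs = real_vector + t2_space + topological_ab_group_add +
  assumes tendsto_scaleR_nhds:
    "filterlim (\<lambda>z. fst z *\<^sub>R snd z) (nhds (a *\<^sub>R x)) (nhds a \<times>\<^sub>F nhds x)"
  assumes locally_convex_unfolded:
    "open U \<Longrightarrow> 0 \<in> U \<Longrightarrow>
     \<exists>V. open V \<and> (\<forall>x\<in>V. \<forall>y\<in>V. \<forall>u\<ge>0. \<forall>v\<ge>0. u + v = 1 \<longrightarrow> u *\<^sub>R x + v *\<^sub>R y \<in> V)
         \<and> 0 \<in> V \<and> V \<subseteq> U"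

lemma locally_convex:
  fixes U :: "'a::hausdorff_lctvs set"
  assumes "open U" "0 \<in> U"
  shows "\<exists>V. open V \<and> convex V \<and> 0 \<in> V \<and> V \<subseteq> U"
  using locally_convex_unfolded[OF assms] unfolding convex_def .

instance real_normed_vector < hausdorff_lctvs
proof
  fix a :: real and x :: 'a
  have 1: "(fst \<longlongrightarrow> a) (nhds a \<times>\<^sub>F nhds x)"
    by (rule filterlim_fst)
  have 2: "(snd \<longlongrightarrow> x) (nhds a \<times>\<^sub>F nhds x)"
    by (rule filterlim_snd)
  show "((\<lambda>z. fst z *\<^sub>R snd z) \<longlongrightarrow> a *\<^sub>R x) (nhds a \<times>\<^sub>F nhds x)"
    by (rule tendsto_scaleR [OF 1 2])
next
  fix U :: "'a set"
  assume "open U" "0 \<in> U"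
  then obtain e where "e > 0" "ball 0 e \<subseteq> U"
    using open_contains_ball by blast
  then show "\<exists>V. open V \<and> (\<forall>x\<in>V. \<forall>y\<in>V. \<forall>u\<ge>0. \<forall>v\<ge>0. u + v = 1 \<longrightarrow> u *\<^sub>R x + v *\<^sub>R y \<in> V)
      \<and> 0 \<in> V \<and> V \<subseteq> U"
    unfolding convex_def[symmetric] by (intro exI[of _ "ball 0 e"]) auto
qed

lemma hausdorff_lctvs_tendsto_scaleR:
  fixes g :: "'b \<Rightarrow> 'a::hausdorff_lctvs"
  assumes "(f \<longlongrightarrow> a) F" "(g \<longlongrightarrow> x) F"
  shows "((\<lambda>t. f t *\<^sub>R g t) \<longlongrightarrow> a *\<^sub>R x) F"
  using filterlim_compose[OF tendsto_scaleR_nhds filterlim_Pair[OF assms]] by simp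

locale tvs_cone =
  fixes P :: "'e::hausdorff_lctvs set"
  assumes nonempty: "P \<noteq> {}"
    and add_closed: "\<And>x y. x \<in> P \<Longrightarrow> y \<in> P \<Longrightarrow> x + y \<in> P"
    and scale_closed: "\<And>r x. 0 \<le> r \<Longrightarrow> x \<in> P \<Longrightarrow> r *\<^sub>R x \<in> P"
    and pointed: "P \<inter> uminus ` P = {0}"
    and closed: "closed P"
    and interior_nonempty: "interior P \<noteq> {}"
begin

definition cone_le :: "'e \<Rightarrow> 'e \<Rightarrow> bool"  (infix "\<preceq>" 50)
  where "x \<preceq> y \<longleftrightarrow> y - x \<in> P"

definition cone_ll :: "'e \<Rightarrow> 'e \<Rightarrow> bool"  (infix "\<lless>" 50)
  where "x \<lless> y \<longleftrightarrow> y - x \<in> interior P"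

end

locale tvs_cone_metric_space = tvs_cone P for P :: "'e::hausdorff_lctvs set" +
  fixes X :: "'a set" and p :: "'a \<Rightarrow> 'a \<Rightarrow> 'e"
  assumes carrier_nonempty: "X \<noteq> {}"
    and nonneg: "\<And>x y. x \<in> X \<Longrightarrow> y \<in> X \<Longrightarrow> 0 \<preceq> p x y"
    and zero_iff: "\<And>x y. x \<in> X \<Longrightarrow> y \<in> X \<Longrightarrow> p x y = 0 \<longleftrightarrow> x = y"
    and commute: "\<And>x y. x \<in> X \<Longrightarrow> y \<in> X \<Longrightarrow> p x y = p y x"
    and triangle: "\<And>x y z. x \<in> X \<Longrightarrow> y \<in> X \<Longrightarrow> z \<in> X \<Longrightarrow> p x y \<preceq> p x z + p z y"
begin

definition cone_ball :: "'a \<Rightarrow> 'e \<Rightarrow> 'a set"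
  where "cone_ball x c = {y \<in> X. p x y \<lless> c}"

text \<open>The empty set satisfies the condition vacuously. That the condition does define a
  topology, with carrier \<open>X\<close>, is shown below.\<close>

definition cone_topology :: "'a topology"
  where "cone_topology =
    topology (\<lambda>U. U \<subseteq> X \<and> (\<forall>x\<in>U. \<exists>c. 0 \<lless> c \<and> cone_ball x c \<subseteq> U))"

end

context tvs_cone
begin

lemma add_interior:
  assumes "x \<in> P" "y \<in> interior P"
  shows "x + y \<in> interior P"
proof (rule interiorI)
  have "continuous_on UNIV (\<lambda>z. z - x)"
    unfolding continuous_on_def by (auto intro!: tendsto_diff tendsto_ident_at tendsto_const)
  then show "open ((\<lambda>z. z - x) -` interior P)"
    by (intro open_vimage) auto
  show "x + y \<in> (\<lambda>z. z - x) -` interior P"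
    using assms by simp
  show "(\<lambda>z. z - x) -` interior P \<subseteq> P"
  proof
    fix z assume "z \<in> (\<lambda>z. z - x) -` interior P"
    then have "z - x \<in> P"
      using interior_subset by auto
    from add_closed[OF this assms(1)] show "z \<in> P" by simp
  qed
qed

lemma scale_interior:
  assumes "0 < r" "x \<in> interior P"
  shows "r *\<^sub>R x \<in> interior P"
proof (rule interiorI)
  have "continuous_on UNIV (\<lambda>z::'e. inverse r *\<^sub>R z)"
    unfolding continuous_on_def
    by (auto intro!: hausdorff_lctvs_tendsto_scaleR tendsto_ident_at tendsto_const)
  then show "open ((\<lambda>z. inverse r *\<^sub>R z) -` interior P)"
    by (intro open_vimage) auto
  show "r *\<^sub>R x \<in> (\<lambda>z. inverse r *\<^sub>R z) -` interior P"
    using assms by simp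
  show "(\<lambda>z. inverse r *\<^sub>R z) -` interior P \<subseteq> P"
  proof
    fix z assume "z \<in> (\<lambda>z. inverse r *\<^sub>R z) -` interior P"
    then have "inverse r *\<^sub>R z \<in> P"
      using interior_subset by auto
    from scale_closed[OF _ this, of r] show "z \<in> P"
      using assms by simp
  qed
qed

lemma common_lower_bound:
  assumes "0 \<lless> c" "0 \<lless> d"
  obtains e where "0 \<lless> e" "e \<preceq> c" "e \<preceq> d"
proof -
  have c: "c \<in> interior P" and d: "d \<in> interior P"
    using assms by (auto simp: cone_ll_def)
  have "((\<lambda>t. d - t *\<^sub>R c) \<longlongrightarrow> d - 0 *\<^sub>R c) (at_right (0::real))"
    by (intro tendsto_diff tendsto_const hausdorff_lctvs_tendsto_scaleR tendsto_ident_at)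
  then have "((\<lambda>t. d - t *\<^sub>R c) \<longlongrightarrow> d) (at_right (0::real))"
    by simp
  then have "\<forall>\<^sub>F t in at_right (0::real). d - t *\<^sub>R c \<in> interior P"
    using d by (rule topological_tendstoD[OF _ open_interior])
  moreover have "\<forall>\<^sub>F t in at_right (0::real). t < 1"
    by (rule order_tendstoD(2)[OF tendsto_ident_at]) simp
  moreover have "\<forall>\<^sub>F t in at_right (0::real). 0 < t"
    by (simp add: eventually_at_right_less)
  ultimately have "\<forall>\<^sub>F t in at_right (0::real). d - t *\<^sub>R c \<in> interior P \<and> t < 1 \<and> 0 < t"
    by eventually_elim auto
  then obtain t :: real where t: "d - t *\<^sub>R c \<in> interior P" "t < 1" "0 < t"
    using eventually_happens[of _ "at_right (0::real)"] by auto
  have "(1 - t) *\<^sub>R c \<in> P"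
    using t c interior_subset by (intro scale_closed) auto
  then have "c - t *\<^sub>R c \<in> P"
    by (simp add: scaleR_diff_left)
  with t c show thesis
    using interior_subset by (intro that[of "t *\<^sub>R c"]) (auto simp: cone_ll_def cone_le_def scale_interior)
qed

end

context tvs_cone_metric_space
begin

lemma cone_ball_mono:
  assumes "c \<preceq> d"
  shows "cone_ball x c \<subseteq> cone_ball x d"
  using add_interior assms by (fastforce simp: cone_ball_def cone_ll_def cone_le_def)

lemma openin_cone_topology:
  "openin cone_topology U \<longleftrightarrow> U \<subseteq> X \<and> (\<forall>x\<in>U. \<exists>c. 0 \<lless> c \<and> cone_ball x c \<subseteq> U)"
proof -
  let ?L = "\<lambda>U. U \<subseteq> X \<and> (\<forall>x\<in>U. \<exists>c. 0 \<lless> c \<and> cone_ball x c \<subseteq> U)"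
  have "?L (S \<inter> T)" if S: "?L S" and T: "?L T" for S T
  proof (intro conjI ballI)
    show "S \<inter> T \<subseteq> X" using S by blast
    fix x assume "x \<in> S \<inter> T"
    then obtain c d where cd: "0 \<lless> c" "cone_ball x c \<subseteq> S" "0 \<lless> d" "cone_ball x d \<subseteq> T"
      using S T by blast
    obtain e where "0 \<lless> e" "e \<preceq> c" "e \<preceq> d"
      using common_lower_bound[OF cd(1,3)] .
    then show "\<exists>c. 0 \<lless> c \<and> cone_ball x c \<subseteq> S \<inter> T"
      using cone_ball_mono[of e c x] cone_ball_mono[of e d x] cd by blast
  qed
  moreover have "?L (\<Union>\<K>)" if "\<forall>K\<in>\<K>. ?L K" for \<K>
    using that by (metis Sup_le_iff UnionE Union_upper subset_trans)
  ultimately have "istopology ?L"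
    unfolding istopology_def by blast
  then show ?thesis
    unfolding cone_topology_def by (simp add: topology_inverse')
qed

lemma topspace_cone_topology: "topspace cone_topology = X"
proof -
  obtain c where "0 \<lless> c"
    using interior_nonempty by (auto simp: cone_ll_def)
  then have "openin cone_topology X"
    by (auto simp: openin_cone_topology cone_ball_def)
  then show ?thesis
    by (metis openin_cone_topology openin_subset openin_topspace subset_antisym)
qed

end

text \<open>Paracompact spaces are required to be Hausdorff, as is needed for them to be \<open>T\<^sub>4\<close>.\<close>

definition paracompact_space :: "'a topology \<Rightarrow> bool"
  where "paracompact_space T \<longleftrightarrow>
    Hausdorff_space T \<and>
    (\<forall>\<U>. (\<forall>U\<in>\<U>. openin T U) \<and> \<Union>\<U> = topspace T \<longrightarrow>
      (\<exists>\<V>. (\<forall>V\<in>\<V>. openin T V) \<and> \<Union>\<V> = topspace T \<and>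
           (\<forall>V\<in>\<V>. \<exists>U\<in>\<U>. V \<subseteq> U) \<and> locally_finite_in T \<V>))"

definition T4_space :: "'a topology \<Rightarrow> bool"
  where "T4_space T \<longleftrightarrow> t1_space T \<and> normal_space T"

end

theory Submission
  imports Defs
begin

text \<open>
  A cone with an interior point \<open>e\<close> has a numerical gauge, \<open>v \<mapsto> inf {r > 0. v \<lless> r *\<^sub>R e}\<close>.
  Composing the cone metric \<open>p\<close> with it gives a real-valued metric. It is finite because \<open>e\<close>
  absorbs every vector, subadditive because \<open>P\<close> is closed under sums, and it vanishes only at
  \<open>0\<close> because \<open>P\<close> is closed and pointed. The multiples of \<open>e\<close> are cofinal downwards among
  the vectors \<open>c\<close> with \<open>0 \<lless> c\<close>, so balls of radius \<open>r *\<^sub>R e\<close> already generate the topology of the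
  cone metric and it is the topology of that real metric. The question is thereby reduced to
  metrizable spaces (\<open>metrizable_cone_topology\<close>).

  Metrizable spaces are Hausdorff and normal; their paracompactness is Stone's theorem, for
  which M. E. Rudin's argument is used (\<open>metrizable_imp_paracompact_space\<close>). A well-order of
  the cover assigns each point to the first member that contains it. For \<open>n = 0, 1, \<dots>\<close>, each
  member \<open>U\<close> gives rise to one set of the refinement, the union of the balls of radius
  \<open>1/2^n\<close> around those points assigned to \<open>U\<close> that lie at depth at least \<open>3/2^n\<close> in \<open>U\<close> and
  have not been covered at an earlier stage. The depth keeps the sets of a single stage at a
  distance of at least \<open>1/2^n\<close> from each other, while excluding the points already covered keeps
  the sets of all late stages away from a given point.
\<close>

section \<open>Stone's theorem\<close>

text \<open>Ordering the cover well and letting \<open>own U\<close> be the part of \<open>U\<close> outside its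
  predecessors does more than make the parts disjoint: the part of the later of two members
  misses the whole of the earlier one. This is what
  keeps the sets of one stage of the refinement apart.\<close>

lemma cover_shells:
  fixes \<U> :: "'a set set"
  obtains own :: "'a set \<Rightarrow> 'a set"
  where "\<And>U. own U \<subseteq> U"
    and "\<Union>(own ` \<U>) = \<Union>\<U>"
    and "\<And>U V. U \<in> \<U> \<Longrightarrow> V \<in> \<U> \<Longrightarrow> U \<noteq> V \<Longrightarrow> own U \<inter> V = {} \<or> own V \<inter> U = {}"
proof -
  obtain r where r: "well_order_on \<U> r"
    using well_order_on by blast
  then have wf: "wf (r - Id)" and total: "total_on \<U> r"
    by (auto simp: well_order_on_def linear_order_on_def)
  define own where "own U = U - \<Union>{V \<in> \<U>. (V, U) \<in> r - Id}" for U
  show thesis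
  proof
    show "own U \<subseteq> U" for U
      by (auto simp: own_def)
    show "\<Union>(own ` \<U>) = \<Union>\<U>"
    proof
      show "\<Union>\<U> \<subseteq> \<Union>(own ` \<U>)"
      proof
        fix x assume "x \<in> \<Union>\<U>"
        then obtain U0 where "U0 \<in> {U \<in> \<U>. x \<in> U}"
          by blast
        then obtain U where "U \<in> {U \<in> \<U>. x \<in> U}"
          "\<And>V. (V, U) \<in> r - Id \<Longrightarrow> V \<notin> {U \<in> \<U>. x \<in> U}"
          by (rule wfE_min[OF wf]) (rule that)
        then have "U \<in> \<U>" "x \<in> own U"
          by (auto simp: own_def)
        then show "x \<in> \<Union>(own ` \<U>)"
          by blast
      qed
    qed (auto simp: own_def)
    show "own U \<inter> V = {} \<or> own V \<inter> U = {}" if "U \<in> \<U>" "V \<in> \<U>" "U \<noteq> V" for U V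
      using total that by (auto simp: own_def total_on_def)
  qed
qed

locale shelled_cover = Metric_space M d for M :: "'a set" and d +
  fixes \<U> :: "'a set set" and own :: "'a set \<Rightarrow> 'a set"
  assumes open_cover: "\<And>U. U \<in> \<U> \<Longrightarrow> openin mtopology U"
    and covers: "\<Union>\<U> = M"
    and own_subset: "\<And>U. own U \<subseteq> U"
    and own_covers: "\<Union>(own ` \<U>) = \<Union>\<U>"
    and own_separated:
      "\<And>U V. U \<in> \<U> \<Longrightarrow> V \<in> \<U> \<Longrightarrow> U \<noteq> V \<Longrightarrow> own U \<inter> V = {} \<or> own V \<inter> U = {}"
begin

primrec covered_before :: "nat \<Rightarrow> 'a set" where
  "covered_before 0 = {}"
| "covered_before (Suc n) = covered_before n \<union>
    (\<Union>U\<in>\<U>. \<Union>x\<in>{x \<in> own U - covered_before n. mball x (3/2^n) \<subseteq> U}. mball x (1/2^n))"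

definition centres :: "nat \<Rightarrow> 'a set \<Rightarrow> 'a set"
  where "centres n U = {x \<in> own U - covered_before n. mball x (3/2^n) \<subseteq> U}"

definition piece :: "nat \<Rightarrow> 'a set \<Rightarrow> 'a set"
  where "piece n U = (\<Union>x\<in>centres n U. mball x (1/2^n))"

lemma covered_before_Suc: "covered_before (Suc n) = covered_before n \<union> \<Union>(piece n ` \<U>)"
  by (simp add: piece_def centres_def)

lemma covered_before_eq: "covered_before n = (\<Union>k<n. \<Union>(piece k ` \<U>))"
  by (induction n) (auto simp: covered_before_Suc lessThan_Suc simp del: covered_before.simps(2))

lemma openin_piece: "openin mtopology (piece n U)"
  unfolding piece_def by (intro openin_Union) auto

lemma piece_subset: "piece n U \<subseteq> U"
proof -
  have "mball x (1/2^n) \<subseteq> mball x (3/2^n)" for x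
    by (intro mball_subset_concentric divide_right_mono) auto
  then show ?thesis
    unfolding piece_def centres_def by blast
qed

text \<open>A point lies deep enough in its own member for all large \<open>n\<close>, and then it is a centre
  unless some earlier stage has covered it.\<close>

lemma pieces_cover: "(\<Union>n. \<Union>(piece n ` \<U>)) = M"
proof
  show "(\<Union>n. \<Union>(piece n ` \<U>)) \<subseteq> M"
    using piece_subset covers by blast
  show "M \<subseteq> (\<Union>n. \<Union>(piece n ` \<U>))"
  proof
    fix x assume "x \<in> M"
    then obtain U where U: "U \<in> \<U>" "x \<in> own U"
      using own_covers covers by blast
    then obtain r where r: "r > 0" "mball x r \<subseteq> U"
      using open_cover own_subset unfolding openin_mtopology by blast
    obtain n where "(1/2)^n < r/3"
      using real_arch_pow_inv[of "r/3" "1/2"] r by auto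
    then have "3/2^n \<le> r"
      by (simp add: power_divide)
    then have "mball x (3/2^n) \<subseteq> U"
      using r mball_subset_concentric by blast
    then have "x \<in> piece n U \<or> x \<in> covered_before n"
      using U \<open>x \<in> M\<close> by (force simp: piece_def centres_def)
    then show "x \<in> (\<Union>n. \<Union>(piece n ` \<U>))"
      using U by (auto simp: covered_before_eq)
  qed
qed

text \<open>One of the two sets of centres misses the other member, to whose centres the depth
  condition applies, so centres of different members are \<open>3/2^n\<close> apart. The two radii leave
  \<open>1/2^n\<close>.\<close>

lemma pieces_of_same_stage_apart:
  assumes "U \<in> \<U>" "V \<in> \<U>" "U \<noteq> V" "x \<in> piece n U" "y \<in> piece n V"
  shows "1/2^n \<le> d x y"
proof -
  obtain a b where a: "a \<in> centres n U" "x \<in> mball a (1/2^n)"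
    and b: "b \<in> centres n V" "y \<in> mball b (1/2^n)"
    using assms by (auto simp: piece_def)
  have M: "a \<in> M" "b \<in> M" "x \<in> M" "y \<in> M"
    using a b by auto
  have "b \<notin> mball a (3/2^n) \<or> a \<notin> mball b (3/2^n)"
    using own_separated[OF assms(1-3)] a b by (auto simp: centres_def)
  then have "3 * (1/2^n) \<le> d a b"
    using M by (auto simp: commute)
  moreover have "d a b \<le> d a x + d x y + d b y"
    using M triangle[of a x b] triangle'[of x y b] by linarith
  ultimately show ?thesis
    using a b by auto
qed

text \<open>Centres chosen after stage \<open>n\<close> lie outside every piece of stage \<open>n\<close>, and hence outside
  every ball inside such a piece.\<close>

lemma late_piece_far:
  assumes "U \<in> \<U>" "mball x (1/2^j) \<subseteq> piece n U" "n < i" "x \<in> M" "y \<in> piece i V"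
  shows "1/2^j - 1/2^i < d x y"
proof -
  obtain a where a: "a \<in> centres i V" "y \<in> mball a (1/2^i)"
    using assms by (auto simp: piece_def)
  then have "a \<notin> piece n U"
    using assms by (auto simp: centres_def covered_before_eq)
  then have "1/2^j \<le> d x a"
    using assms a by force
  also have "\<dots> \<le> d x y + d a y"
    using a assms by (auto intro: triangle')
  finally show ?thesis
    using a by auto
qed

lemma locally_finite_pieces:
  "locally_finite_in mtopology (\<Union>n. piece n ` \<U>)"
  unfolding locally_finite_in_def topspace_mtopology
proof (intro conjI ballI)
  show "\<Union>(\<Union>n. piece n ` \<U>) \<subseteq> M"
    using pieces_cover by blast
  fix x assume x: "x \<in> M"
  then obtain n U where U: "U \<in> \<U>" "x \<in> piece n U"
    using pieces_cover by blast
  then obtain r where r: "r > 0" "mball x r \<subseteq> piece n U"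
    using openin_piece unfolding openin_mtopology by blast
  obtain j where "(1/2)^j < r"
    using real_arch_pow_inv[of r "1/2"] r by auto
  then have j: "mball x (1/2^j) \<subseteq> piece n U"
    using r mball_subset_concentric[of "1/2^j" r x] by (simp add: power_divide)
  \<comment> \<open>As \<open>m > n\<close> and \<open>m > j\<close>, the pieces of the stages from \<open>m\<close> on stay outside the ball. For
    \<open>i < m\<close> its diameter is too small for two pieces of stage \<open>i\<close>.\<close>
  define m where "m = n + j + 1"
  let ?B = "mball x (1/2^m)"
  have late: "i < m" if "piece i V \<inter> ?B \<noteq> {}" for i V
  proof (rule ccontr)
    assume "\<not> i < m"
    then have "n < i" "(1::real)/2^i \<le> 1/2^Suc j" "(1::real)/2^m \<le> 1/2^Suc j"
      by (auto simp: m_def intro!: divide_left_mono power_increasing simp del: power_Suc)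
    moreover from that obtain y where "y \<in> piece i V" "d x y < 1/2^m"
      by auto
    ultimately show False
      using late_piece_far[OF U(1) j _ x, of i y V] by simp
  qed
  have single: "finite {V \<in> \<U>. piece i V \<inter> ?B \<noteq> {}}" if "i < m" for i
  proof -
    have "V = W" if V: "V \<in> \<U>" "piece i V \<inter> ?B \<noteq> {}" and W: "W \<in> \<U>" "piece i W \<inter> ?B \<noteq> {}"
      for V W
    proof (rule ccontr)
      assume "V \<noteq> W"
      obtain y z where yz: "y \<in> piece i V" "z \<in> piece i W" "y \<in> ?B" "z \<in> ?B"
        using V W by blast
      have "(1::real)/2^m \<le> 1/2^Suc i"
        using \<open>i < m\<close> by (intro divide_left_mono power_increasing) auto
      moreover have "d y z \<le> d x y + d x z"
        using yz by (intro triangle'') auto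
      moreover have "1/2^i \<le> d y z"
        using pieces_of_same_stage_apart[OF V(1) W(1) \<open>V \<noteq> W\<close> yz(1,2)] .
      ultimately show False
        using yz by simp
    qed
    then have "{V \<in> \<U>. piece i V \<inter> ?B \<noteq> {}} \<subseteq> {W}"
      if "W \<in> {V \<in> \<U>. piece i V \<inter> ?B \<noteq> {}}" for W
      using that by blast
    then show ?thesis
      by (metis (lifting) all_not_in_conv finite.emptyI finite.insertI finite_subset)
  qed
  have "{S \<in> (\<Union>n. piece n ` \<U>). S \<inter> ?B \<noteq> {}} \<subseteq>
      (\<Union>i<m. piece i ` {V \<in> \<U>. piece i V \<inter> ?B \<noteq> {}})"
    using late by blast
  moreover have "finite \<dots>"
    using single by auto
  ultimately have "finite {S \<in> (\<Union>n. piece n ` \<U>). S \<inter> ?B \<noteq> {}}"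
    by (rule finite_subset)
  then show "\<exists>V. openin mtopology V \<and> x \<in> V \<and> finite {S \<in> (\<Union>n. piece n ` \<U>). S \<inter> V \<noteq> {}}"
    using x by (intro exI[of _ ?B]) auto
qed

end

theorem metrizable_imp_paracompact_space:
  assumes "metrizable_space T"
  shows "paracompact_space T"
  unfolding paracompact_space_def
proof (intro conjI allI impI)
  show "Hausdorff_space T"
    using assms by (rule metrizable_imp_Hausdorff_space)
  fix \<U> assume \<U>: "(\<forall>U\<in>\<U>. openin T U) \<and> \<Union>\<U> = topspace T"
  obtain M d where "Metric_space M d" and T: "T = Metric_space.mtopology M d"
    using assms by (auto simp: metrizable_space_def)
  then interpret Metric_space M d
    by simp
  obtain own where "\<And>U. own U \<subseteq> U" "\<Union>(own ` \<U>) = \<Union>\<U>"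
    "\<And>U V. U \<in> \<U> \<Longrightarrow> V \<in> \<U> \<Longrightarrow> U \<noteq> V \<Longrightarrow> own U \<inter> V = {} \<or> own V \<inter> U = {}"
    using cover_shells[of \<U>] by metis
  then interpret shelled_cover M d \<U> own
    using \<U> by unfold_locales (simp_all add: T)
  show "\<exists>\<V>. (\<forall>V\<in>\<V>. openin T V) \<and> \<Union>\<V> = topspace T \<and>
      (\<forall>V\<in>\<V>. \<exists>U\<in>\<U>. V \<subseteq> U) \<and> locally_finite_in T \<V>"
  proof (intro exI conjI)
    show "locally_finite_in T (\<Union>n. piece n ` \<U>)"
      unfolding T by (rule locally_finite_pieces)
    have "\<Union>(\<Union>n. A n) = (\<Union>n. \<Union>(A n))" for A :: "nat \<Rightarrow> 'a set set"
      by blast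
    then show "\<Union>(\<Union>n. piece n ` \<U>) = topspace T"
      using pieces_cover by (simp only: T topspace_mtopology)
    show "\<forall>V\<in>(\<Union>n. piece n ` \<U>). openin T V"
      by (auto simp: T openin_piece)
    show "\<forall>V\<in>(\<Union>n. piece n ` \<U>). \<exists>U\<in>\<U>. V \<subseteq> U"
      using piece_subset by blast
  qed
qed

section \<open>The gauge of an interior point of a cone\<close>

context tvs_cone
begin

lemma ll_imp_le: "x \<lless> y \<Longrightarrow> x \<preceq> y"
  using interior_subset by (auto simp: cone_ll_def cone_le_def)

lemma le_ll_trans: "x \<preceq> y \<Longrightarrow> y \<lless> z \<Longrightarrow> x \<lless> z"
  using add_interior[of "y - x" "z - y"] by (simp add: cone_ll_def cone_le_def)

lemma ll_add: "u \<lless> a \<Longrightarrow> v \<lless> b \<Longrightarrow> u + v \<lless> a + b"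
  using add_interior[of "a - u" "b - v"] interior_subset[of P]
  by (auto simp: cone_ll_def algebra_simps)

lemma scale_ll_mono:
  assumes "0 \<lless> e" "v \<lless> r *\<^sub>R e" "r \<le> s"
  shows "v \<lless> s *\<^sub>R e"
proof -
  have "(s - r) *\<^sub>R e \<in> P"
    using assms interior_subset by (intro scale_closed) (auto simp: cone_ll_def)
  from add_interior[OF this, of "r *\<^sub>R e - v"] assms(2) show ?thesis
    by (simp add: cone_ll_def algebra_simps)
qed

text \<open>Interior points absorb: \<open>c - t *\<^sub>R v\<close> tends to the interior point \<open>c\<close> as \<open>t\<close> decreases
  to \<open>0\<close>.\<close>

lemma ex_small_multiple_ll:
  assumes "0 \<lless> c"
  obtains t :: real where "0 < t" "t *\<^sub>R v \<lless> c"
proof -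
  have "((\<lambda>t. c - t *\<^sub>R v) \<longlongrightarrow> c - 0 *\<^sub>R v) (at_right (0::real))"
    by (intro tendsto_diff tendsto_const hausdorff_lctvs_tendsto_scaleR tendsto_ident_at)
  then have "\<forall>\<^sub>F t in at_right (0::real). c - t *\<^sub>R v \<in> interior P"
    using assms by (intro topological_tendstoD[OF _ open_interior]) (auto simp: cone_ll_def)
  then have "\<forall>\<^sub>F t in at_right (0::real). 0 < t \<and> c - t *\<^sub>R v \<in> interior P"
    by (intro eventually_conj) (simp_all add: eventually_at_right_less)
  from eventually_happens[OF this] that show thesis
    by (auto simp: cone_ll_def)
qed

definition gauge_value :: "'e \<Rightarrow> 'e \<Rightarrow> real"
  where "gauge_value e v = Inf {r. 0 < r \<and> v \<lless> r *\<^sub>R e}"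

context
  fixes e :: 'e
  assumes e: "0 \<lless> e"
begin

lemma gauge_set_nonempty: "{r. 0 < r \<and> v \<lless> r *\<^sub>R e} \<noteq> {}"
proof -
  obtain t where "0 < t" "t *\<^sub>R v \<lless> e"
    using ex_small_multiple_ll[OF e] .
  then have "v \<lless> (1/t) *\<^sub>R e"
    using scale_interior[of "1/t" "e - t *\<^sub>R v"] by (simp add: cone_ll_def algebra_simps)
  with \<open>0 < t\<close> show ?thesis
    by (auto intro!: exI[of _ "1/t"])
qed

lemma gauge_nonneg: "0 \<le> gauge_value e v"
  unfolding gauge_value_def using gauge_set_nonempty by (intro cInf_greatest) auto

lemma gauge_le: "0 < r \<Longrightarrow> v \<lless> r *\<^sub>R e \<Longrightarrow> gauge_value e v \<le> r"
  unfolding gauge_value_def by (intro cInf_lower bdd_belowI[of _ 0]) auto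

lemma gauge_less_imp_ll:
  assumes "gauge_value e v < r"
  shows "v \<lless> r *\<^sub>R e"
proof -
  obtain s where "v \<lless> s *\<^sub>R e" "s < r"
    using cInf_lessD[OF gauge_set_nonempty assms[unfolded gauge_value_def]] by auto
  then show ?thesis
    using scale_ll_mono[OF e] by simp
qed

lemma gauge_subadditive:
  assumes "w \<preceq> u + v"
  shows "gauge_value e w \<le> gauge_value e u + gauge_value e v"
proof (rule field_le_epsilon)
  fix \<epsilon> :: real assume "0 < \<epsilon>"
  define r s where "r = gauge_value e u + \<epsilon>/2" and "s = gauge_value e v + \<epsilon>/2"
  have "u \<lless> r *\<^sub>R e" "v \<lless> s *\<^sub>R e"
    using \<open>0 < \<epsilon>\<close> by (auto simp: r_def s_def intro!: gauge_less_imp_ll)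
  then have "w \<lless> (r + s) *\<^sub>R e"
    using le_ll_trans[OF assms ll_add] by (simp add: scaleR_add_left)
  moreover have "0 < r + s"
    using \<open>0 < \<epsilon>\<close> gauge_nonneg[of u] gauge_nonneg[of v] by (simp add: r_def s_def)
  ultimately show "gauge_value e w \<le> gauge_value e u + gauge_value e v + \<epsilon>"
    using gauge_le[of "r + s" w] by (simp add: r_def s_def)
qed

text \<open>If the gauge of \<open>v\<close> vanishes, then \<open>r *\<^sub>R e - v \<in> P\<close> for all \<open>r > 0\<close>, and as \<open>P\<close> is closed,
  \<open>- v \<in> P\<close> in the limit.\<close>

lemma gauge_eq_0_iff:
  assumes "0 \<preceq> v"
  shows "gauge_value e v = 0 \<longleftrightarrow> v = 0"
proof
  assume "v = 0"
  then have "gauge_value e v \<le> 0 + \<epsilon>" if "0 < \<epsilon>" for \<epsilon>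
    using that e scale_interior[of \<epsilon> e] by (intro order.trans[OF gauge_le[of \<epsilon>]]) (auto simp: cone_ll_def)
  then have "gauge_value e v \<le> 0"
    by (rule field_le_epsilon)
  then show "gauge_value e v = 0"
    using gauge_nonneg[of v] by simp
next
  assume 0: "gauge_value e v = 0"
  have "((\<lambda>r. r *\<^sub>R e - v) \<longlongrightarrow> 0 *\<^sub>R e - v) (at_right (0::real))"
    by (intro tendsto_diff tendsto_const hausdorff_lctvs_tendsto_scaleR tendsto_ident_at)
  moreover have "\<forall>\<^sub>F r in at_right (0::real). r *\<^sub>R e - v \<in> P"
    using eventually_at_right_less
  proof eventually_elim
    case (elim r)
    then have "v \<preceq> r *\<^sub>R e"
      using 0 by (intro ll_imp_le gauge_less_imp_ll) simp
    then show ?case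
      by (simp add: cone_le_def)
  qed
  ultimately have "0 *\<^sub>R e - v \<in> P"
    by (intro Lim_in_closed_set[OF closed]) auto
  then have "v \<in> P \<inter> uminus ` P"
    using assms by (force simp: cone_le_def)
  then show "v = 0"
    using pointed by simp
qed

end

end

section \<open>Metrizability of the cone topology\<close>

theorem (in tvs_cone_metric_space) metrizable_cone_topology:
  "metrizable_space cone_topology"
proof -
  obtain e where e: "0 \<lless> e"
    using interior_nonempty by (auto simp: cone_ll_def)
  \<comment> \<open>The guard is there because \<^locale>\<open>Metric_space\<close> asks for symmetry off the carrier too.\<close>
  define d where "d x y = (if x \<in> X \<and> y \<in> X then gauge_value e (p x y) else 0)" for x y
  interpret d: Metric_space X d
  proof
    show "0 \<le> d x y" for x y
      by (simp add: d_def gauge_nonneg[OF e])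
    show "d x y = d y x" for x y
      by (simp add: d_def commute)
    show "d x y = 0 \<longleftrightarrow> x = y" if "x \<in> X" "y \<in> X" for x y
      using that by (simp add: d_def gauge_eq_0_iff[OF e] nonneg zero_iff)
    show "d x z \<le> d x y + d y z" if "x \<in> X" "y \<in> X" "z \<in> X" for x y z
      using that by (simp add: d_def gauge_subadditive[OF e] triangle)
  qed
  have ball_subset: "d.mball x r \<subseteq> cone_ball x (r *\<^sub>R e)" for x r
    by (auto simp: d_def cone_ball_def gauge_less_imp_ll[OF e])
  have cone_ball_subset: "cone_ball x ((r/2) *\<^sub>R e) \<subseteq> d.mball x r" if "0 < r" "x \<in> X" for x r
    using that gauge_le[OF e, of "r/2"] by (fastforce simp: d_def cone_ball_def)
  have "openin cone_topology U \<longleftrightarrow> openin d.mtopology U" for U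
    unfolding openin_cone_topology d.openin_mtopology
  proof (intro conj_cong refl iffI)
    assume U: "\<forall>x\<in>U. \<exists>c. 0 \<lless> c \<and> cone_ball x c \<subseteq> U"
    show "\<forall>x. x \<in> U \<longrightarrow> (\<exists>r>0. d.mball x r \<subseteq> U)"
    proof (intro allI impI)
      fix x assume "x \<in> U"
      with U obtain c where c: "0 \<lless> c" "cone_ball x c \<subseteq> U"
        by blast
      obtain t where t: "0 < t" "t *\<^sub>R e \<lless> c"
        using ex_small_multiple_ll[OF c(1)] .
      then have "d.mball x t \<subseteq> U"
        using ball_subset cone_ball_mono[OF ll_imp_le] c(2) by blast
      with t show "\<exists>r>0. d.mball x r \<subseteq> U"
        by blast
    qed
  next
    assume "U \<subseteq> X" and U: "\<forall>x. x \<in> U \<longrightarrow> (\<exists>r>0. d.mball x r \<subseteq> U)"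
    show "\<forall>x\<in>U. \<exists>c. 0 \<lless> c \<and> cone_ball x c \<subseteq> U"
    proof
      fix x assume "x \<in> U"
      with U obtain r where r: "0 < r" "d.mball x r \<subseteq> U"
        by blast
      then have "0 \<lless> (r/2) *\<^sub>R e"
        using e scale_interior[of "r/2" e] by (simp add: cone_ll_def)
      moreover have "cone_ball x ((r/2) *\<^sub>R e) \<subseteq> U"
        using r cone_ball_subset \<open>x \<in> U\<close> \<open>U \<subseteq> X\<close> by blast
      ultimately show "\<exists>c. 0 \<lless> c \<and> cone_ball x c \<subseteq> U"
        by blast
    qed
  qed
  then have "cone_topology = d.mtopology"
    by (simp add: topology_eq)
  then show ?thesis
    using d.metrizable_space_mtopology by simp
qed

theorem corollary19:
  fixes P :: "'e::hausdorff_lctvs set"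
    and X :: "'a set"
    and p :: "'a \<Rightarrow> 'a \<Rightarrow> 'e"
  assumes "tvs_cone_metric_space P X p"
  shows "paracompact_space (tvs_cone_metric_space.cone_topology P X p) \<and>
         T4_space (tvs_cone_metric_space.cone_topology P X p)"
proof -
  interpret tvs_cone_metric_space P X p
    by (rule assms)
  show ?thesis
    using metrizable_cone_topology unfolding T4_space_def
    by (simp add: metrizable_imp_paracompact_space metrizable_imp_t1_space
        metrizable_imp_normal_space)
qed

end
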